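(* Let $t \geq 1$ be an even integer and let $0<\varepsilon<1/2$. There is an $n_0 = n_0(t,\varepsilon)$ such that for every odd integer $n \geq n_0$ there is a $k$-regular $n$-vertex graph containing no subgraph isomorphic to $K_{2,2t+1}$ with \[ k \geq (1-2\varepsilon)^{1/2} \sqrt{tn/5}. \]
   Context: Graphs are finite and simple; $K_{2,2t+1}$ is the complete bipartite graph with parts of sizes $2$ and $2t+1$. *)

theory Defs
  imports Complex_Main "Graph_Theory.Graph_Theory"
begin

text \<open>
  A finite simple graph is rendered by the locale predicate \<open>graph\<close> of the AFP graph library: each
  undirected edge is a pair of mutually reversed arcs, without loops or parallel arcs.
  Hence \<open>out_degree\<close> is the ordinary degree.
\<close>

definition regular_graph :: "nat \<Rightarrow> ('a, 'b) pre_digraph \<Rightarrow> bool" where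
  "regular_graph k G \<longleftrightarrow> graph G \<and> (\<forall>v\<in>verts G. out_degree G v = k)"

text \<open>
  \<open>K\<^bsub>a,b\<^esub> H\<close> says that \<open>H\<close> itself is a complete bipartite graph with disjoint parts of sizes
  \<open>a\<close> and \<open>b\<close>, i.e. is isomorphic to it; \<open>subgraph\<close> is not required to be induced.
\<close>

definition complete_bipartite_free :: "nat \<Rightarrow> nat \<Rightarrow> ('a, 'b) pre_digraph \<Rightarrow> bool" where
  "complete_bipartite_free a b G \<longleftrightarrow> \<not> (\<exists>H. subgraph H G \<and> K\<^bsub>a,b\<^esub> H)"

end

theory Submission
  imports Defs "HOL-Real_Asymp.Real_Asymp" "HOL-Number_Theory.Number_Theory"
begin

text \<open>
  Put \<open>g = t - 1\<close> and \<open>N = g n\<close>. Ruzsa's Sidon set modulo \<open>p (p - 1)\<close>, for a prime \<open>p\<close> within a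
  constant factor of \<open>sqrt N\<close>, has a window of length \<open>N\<close> holding a Sidon set of size
  \<open>0.64 sqrt N\<close>; averaging over windows makes a Bertrand-type estimate for \<open>p\<close> sufficient.
  Modulo \<open>n\<close> every nonzero residue lifts to \<open>2 g\<close> integers in \<open>[-N, N)\<close>, hence is a difference in
  at most \<open>2 g\<close> ways. In the graph \<open>u + w \<in> S\<close> on the integers modulo \<open>n\<close>, distinct vertices
  therefore have at most \<open>2 g\<close> common neighbours. As \<open>n\<close> is odd, each element of \<open>S\<close> causes exactly
  one loop; replacing the loops by a perfect matching of the loop vertices restores regularity and
  adds at most 2 common neighbours, \<open>2 g + 2 = 2 t\<close> in total. Since \<open>t \<le> 2 g\<close>, the degree
  \<open>0.64 sqrt N - O(t)\<close> beats \<open>sqrt (t n / 5) \<le> sqrt (0.4 N)\<close>.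
\<close>

section \<open>Primes in short multiplicative intervals\<close>

text \<open>Integrality along Leibniz' harmonic triangle.\<close>

lemma Suc_mult_choose_dvd:
  fixes D :: nat
  assumes "m \<le> n" "\<And>j. 1 \<le> j \<Longrightarrow> j \<le> Suc n \<Longrightarrow> j dvd D"
  shows "Suc n * (n choose m) dvd D"
proof -
  have "real D / real (Suc n * (n choose m)) \<in> \<int>"
    using assms
  proof (induction m arbitrary: n)
    case 0
    then have "Suc n dvd D" by simp
    then obtain k where "D = Suc n * k" by blast
    then have "real D / real (Suc n * (n choose 0)) = real k"
      by (simp add: field_simps)
    then show ?case by (metis Ints_of_nat)
  next
    case (Suc m)
    then obtain k where k: "n = Suc k" "m \<le> k" by (cases n) auto
    define c where "c = real (k choose m)"
    have c: "c > 0" using k by (simp add: c_def)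
    have 1: "real (Suc m) * real (Suc k choose Suc m) = real (Suc k) * c"
      unfolding c_def using Suc_times_binomial[of m k] by (metis of_nat_mult)
    have 2: "real (Suc k - m) * real (Suc k choose m) = real (Suc k) * c"
      unfolding c_def using binomial_absorb_comp[of "Suc k" m] by (metis diff_Suc_1 of_nat_mult)
    have e1: "real (Suc k choose Suc m) = real (Suc k) * c / real (Suc m)"
      using 1 by (simp add: field_simps)
    have e2: "real (Suc k choose m) = real (Suc k) * c / (real (Suc k) - real m)"
      using 2 k by (simp add: field_simps of_nat_diff)
    \<comment> \<open>Rule of Leibniz' triangle: an entry in column \<open>Suc m\<close> is the
      difference of two entries in column \<open>m\<close>, in rows \<open>k\<close> and
      \<open>Suc k\<close>, both covered by the induction hypothesis.\<close>
    have "real D / real (Suc n * (n choose Suc m)) =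
        real D / real (Suc k * (k choose m)) - real D / real (Suc (Suc k) * (Suc k choose m))"
      unfolding k of_nat_mult e1 e2 c_def[symmetric] using c k
      by (simp add: divide_simps) (simp add: algebra_simps)
    moreover have "real D / real (Suc k * (k choose m)) \<in> \<int>"
      using Suc k by (intro Suc.IH) auto
    moreover have "real D / real (Suc (Suc k) * (Suc k choose m)) \<in> \<int>"
      using Suc k by (intro Suc.IH) auto
    ultimately show ?case by simp
  qed
  then obtain z :: int where "real D / real (Suc n * (n choose m)) = z"
    by (auto elim: Ints_cases)
  then have "real D = real_of_int z * real (Suc n * (n choose m))"
    using assms(1) by (metis nonzero_divide_eq_eq of_nat_eq_0_iff mult_eq_0_iff nat.distinct(1) binomial_eq_0_iff not_less)
  then have "int D = z * int (Suc n * (n choose m))"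
    by (metis of_int_eq_iff of_int_mult of_int_of_nat_eq)
  then show ?thesis
    by (metis dvd_triv_right int_dvd_int_iff)
qed

section \<open>Chebyshev-type bounds for primes\<close>

lemma prod_primes_dvd:
  fixes x :: nat
  assumes "finite P" "\<And>p. p \<in> P \<Longrightarrow> prime p \<and> p dvd x"
  shows "\<Prod>P dvd x"
  using assms
proof (induction P rule: finite_induct)
  case (insert p P)
  have "coprime p (\<Prod>P)"
    using insert by (intro prod_coprime_right primes_coprime) auto
  then show ?case using insert by (simp add: divides_mult)
qed simp

text \<open>The two middle coefficients of row \<open>2 * m + 1\<close> are equal and together at
  most the row sum \<open>2 ^ (2 * m + 1)\<close>.\<close>

lemma choose_middle_le: "(Suc (2 * m) choose m) \<le> 4 ^ m"
proof -
  have "(Suc (2*m) choose m) + (Suc (2*m) choose Suc m) = (\<Sum>k\<in>{m, Suc m}. Suc (2*m) choose k)"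
    by simp
  also have "\<dots> \<le> (\<Sum>k\<le>Suc (2*m). Suc (2*m) choose k)"
    by (intro sum_mono2) auto
  also have "\<dots> = 2 ^ Suc (2*m)" by (rule choose_row_sum)
  finally have "2 * (Suc (2*m) choose m) \<le> 2 * 2 ^ (2*m)"
    using binomial_symmetric[of m "Suc (2*m)"] by simp
  then show ?thesis by (simp add: power_mult)
qed

text \<open>Induction after Erdos. An even \<open>n > 2\<close> contributes no new prime. For
  \<open>n = 2 * m + 1\<close> the primes in \<open>(m + 1, n]\<close> all divide
  \<open>n choose m\<close>, which is at most \<open>4 ^ m\<close>; the induction hypothesis handles
  those up to \<open>m + 1\<close>.\<close>

lemma primorial_le: "\<Prod>{p. prime p \<and> p \<le> n} \<le> (4::nat) ^ n"
proof (induction n rule: less_induct)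
  case (less n)
  consider "n \<le> 1" | "n = 2" | "n > 2" "even n" | "n > 2" "odd n" by linarith
  then show ?case
  proof cases
    case 1
    then have "{p. prime p \<and> p \<le> n} = {}" by (auto dest: prime_ge_2_nat)
    then show ?thesis by (simp only: prod.empty one_le_power one_le_numeral)
  next
    case 2
    have "{p::nat. prime p \<and> p \<le> 2} = {2}" 
      using order.antisym[OF _ prime_ge_2_nat] by auto
    then show ?thesis using 2 by simp
  next
    case 3
    then have "\<not> prime n" using prime_odd_nat by auto
    then have "{p. prime p \<and> p \<le> n} = {p. prime p \<and> p \<le> n - 1}"
      using 3 by (auto simp: le_less_Suc_eq order.order_iff_strict)
    then have "\<Prod>{p. prime p \<and> p \<le> n} \<le> 4 ^ (n - 1)" using less[of "n-1"] 3 by simp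
    also have "\<dots> \<le> 4 ^ n" by (intro power_increasing) auto
    finally show ?thesis .
  next
    case 4
    then obtain m where m: "n = Suc (2 * m)" "m \<ge> 1" by (auto elim!: oddE)
    define P where "P = {p. prime p \<and> Suc m < p \<and> p \<le> n}"
    have eq: "{p. prime p \<and> p \<le> n} = {p. prime p \<and> p \<le> Suc m} \<union> P"
      unfolding P_def using m by auto
    have "\<Prod>P dvd (n choose m)"
    proof (rule prod_primes_dvd)
      show "finite P" by (simp add: P_def)
      fix p assume "p \<in> P"
      then have p: "prime p" "Suc m < p" "p \<le> n" by (auto simp: P_def)
      have "fact n = fact m * fact (Suc m) * (n choose m)"
        using binomial_fact_lemma[of m n] m by simp
      moreover have "p dvd fact n" using p by (simp add: prime_dvd_fact_iff)
      moreover have "\<not> p dvd fact m" "\<not> p dvd fact (Suc m)"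
        using p by (simp_all only: prime_dvd_fact_iff)
      ultimately show "prime p \<and> p dvd (n choose m)"
        using p by (metis prime_dvd_mult_iff)
    qed
    then have "\<Prod>P \<le> (n choose m)" using m by (intro dvd_imp_le) auto
    also have "\<dots> \<le> 4 ^ m" using choose_middle_le m by simp
    finally have "\<Prod>{p. prime p \<and> p \<le> Suc m} * \<Prod>P \<le> 4 ^ Suc m * 4 ^ m"
      using less[of "Suc m"] m by (intro mult_mono) auto
    also have "\<dots> = 4 ^ n" using m by (simp add: power_add mult_2)
    also have "\<Prod>{p. prime p \<and> p \<le> Suc m} * \<Prod>P = \<Prod>{p. prime p \<and> p \<le> n}"
      unfolding eq by (subst prod.union_disjoint) (auto simp: P_def)
    finally show ?thesis .
  qed
qed

text \<open>The hypothesis leaves only the primes up to \<open>y\<close> to build a common multiple of \<open>1, \<dots>, M\<close>;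
  those below \<open>sqrt M\<close> occur with a power at most \<open>M\<close>, the others at most once.\<close>

lemma common_multiple_le:
  assumes M: "M \<ge> 1" and np: "\<And>p. prime p \<Longrightarrow> p \<le> M \<Longrightarrow> p \<le> y"
  obtains D :: nat where "D > 0" "\<And>j. 1 \<le> j \<Longrightarrow> j \<le> M \<Longrightarrow> j dvd D"
    "D \<le> M ^ nat \<lfloor>sqrt M\<rfloor> * 4 ^ y"
proof
  define e where "e p = (GREATEST e. p ^ e \<le> M)" for p :: nat
  \<comment> \<open>Exponents are bounded by \<open>M\<close>, so the \<open>GREATEST\<close>
    defining \<open>e\<close> is attained.\<close>
  have bd: "k \<le> M" if "prime p" "p ^ k \<le> M" for p k
  proof -
    have "k < p ^ k" using power_gt_expt[of p k] prime_gt_1_nat[OF that(1)] by simp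
    then show ?thesis using that by simp
  qed
  have e1: "p ^ e p \<le> M" if "prime p" for p
    unfolding e_def
    by (rule GreatestI_nat[where k = 0 and b = M]) (use that M bd in auto)
  have e2: "k \<le> e p" if "prime p" "p ^ k \<le> M" for p k
    unfolding e_def
    by (rule Greatest_le_nat[where b = M]) (use that bd in auto)
  define P where "P = {p. prime p \<and> p\<^sup>2 \<le> M}"
  define Q where "Q = {p. prime p \<and> p \<le> y}"
  have P: "P \<subseteq> {1..nat \<lfloor>sqrt M\<rfloor>}"
  proof
    fix p assume "p \<in> P"
    then have "p \<ge> 1" "p\<^sup>2 \<le> M"
      using prime_ge_1_nat unfolding P_def by blast+
    then have "real p ^ 2 \<le> real M" by (metis of_nat_le_iff of_nat_power)
    then have "real p \<le> sqrt M" by (simp add: real_le_rsqrt)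
    then show "p \<in> {1..nat \<lfloor>sqrt M\<rfloor>}" using \<open>p \<ge> 1\<close> by (simp add: le_nat_floor)
  qed
  then have fin: "finite P" using finite_subset by blast
  have finQ: "finite Q" unfolding Q_def by simp
  let ?D = "(\<Prod>p\<in>P. p ^ e p) * \<Prod>Q"
  show pos: "?D > 0"
    by (auto simp: P_def Q_def prime_gt_0_nat intro!: prod_pos)
  show "j dvd ?D" if j: "1 \<le> j" "j \<le> M" for j
  proof (rule multiplicity_le_imp_dvd)
    fix p :: nat assume p: "prime p"
    define k where "k = multiplicity p j"
    have "p ^ k dvd j" unfolding k_def by (rule multiplicity_dvd)
    then have kM: "p ^ k \<le> M" using j dvd_imp_le[of "p ^ k" j] by simp
    have "p ^ k dvd ?D"
    proof (cases "p \<in> P")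
      case True
      have "p ^ k dvd p ^ e p" using e2[OF p kM] by (rule le_imp_power_dvd)
      also have "\<dots> dvd (\<Prod>p\<in>P. p ^ e p)" using True fin by (rule dvd_prodI[rotated])
      finally show ?thesis by simp
    next
      case False
      \<comment> \<open>A prime whose square exceeds \<open>M\<close> has exponent at most 1 in
        \<open>j\<close>; if it divides \<open>j\<close>, it lies in \<open>Q\<close> by
        \<open>np\<close>.\<close>
      then have "\<not> p\<^sup>2 \<le> M" using p by (auto simp: P_def)
      moreover have "p\<^sup>2 \<le> p ^ k" if "k \<ge> 2"
        using that p prime_ge_1_nat by (intro power_increasing) auto
      ultimately have "\<not> k \<ge> 2" using kM by linarith
      then have "k \<le> 1" by simp
      show ?thesis
      proof (cases "k = 0")
        case False
        then have "k = 1" using \<open>k \<le> 1\<close> by simp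
        then have "p \<in> Q" using kM p np by (auto simp: Q_def)
        then have "p dvd \<Prod>Q" using finQ dvd_prodI[of Q p "\<lambda>x. x"] by simp
        then show ?thesis using \<open>k = 1\<close> by simp
      qed simp
    qed
    then show "multiplicity p j \<le> multiplicity p ?D"
      unfolding k_def[symmetric] using pos p by (intro multiplicity_geI) (auto simp: prime_nat_iff)
  qed (use j in simp)
  have "(\<Prod>p\<in>P. p ^ e p) \<le> (\<Prod>p\<in>P. M)"
    using e1 by (intro prod_mono) (auto simp: P_def)
  also have "\<dots> = M ^ card P" by simp
  also have "\<dots> \<le> M ^ nat \<lfloor>sqrt M\<rfloor>"
    using M card_mono[OF _ P] by (intro power_increasing) auto
  finally show "?D \<le> M ^ nat \<lfloor>sqrt M\<rfloor> * 4 ^ y"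
    using primorial_le[of y] unfolding Q_def by (intro mult_mono) auto
qed

text \<open>Otherwise all primes up to \<open>2 * n + 1\<close> are at most
  \<open>5 * n / 6\<close>, so \<open>1, ..., 2 * n + 1\<close> have a common multiple of size
  \<open>4 ^ (5 * n / 6)\<close> up to a subexponential factor. But it is a multiple of
  \<open>(2 * n + 1) * (2 * n choose n)\<close>, which is at least \<open>4 ^ n\<close>.\<close>

lemma eventually_prime_between:
  "\<forall>\<^sub>F n :: nat in at_top. \<exists>p. prime p \<and> 5 * n < 6 * p \<and> p \<le> 2 * n + 1"
proof -
  have "\<forall>\<^sub>F x::real in at_top.
      (2*x+1) powr sqrt (2*x+1) * 4 powr (5 * x / 6) < 4 powr x / (2 * x) * (2 * x + 1)"
    by real_asymp
  then have ev: "\<forall>\<^sub>F n::nat in at_top. (2 * real n + 1) powr sqrt (2 * real n + 1) * 4 powr (5 * real n / 6)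
      < 4 powr real n / (2 * real n) * (2 * real n + 1)"
    using filterlim_real_sequentially by (rule eventually_compose_filterlim)
  show ?thesis
    using ev eventually_gt_at_top[of "0::nat"]
  proof eventually_elim
    case (elim n)
    show ?case
    proof (rule ccontr)
      assume A: "\<not> ?thesis"
      let ?M = "2 * n + 1"
      define y where "y = 5 * n div 6"
      have "p \<le> y" if "prime p" "p \<le> ?M" for p
      proof -
        have "\<not> 5 * n < 6 * p" using A that by blast
        then show ?thesis unfolding y_def by linarith
      qed
      then obtain D where D: "D > 0" "\<And>j. 1 \<le> j \<Longrightarrow> j \<le> ?M \<Longrightarrow> j dvd D"
        "D \<le> ?M ^ nat \<lfloor>sqrt ?M\<rfloor> * 4 ^ y"
        using common_multiple_le[of ?M y] by auto
      have "Suc (2*n) * (2*n choose n) dvd D"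
        by (rule Suc_mult_choose_dvd) (use D in auto)
      then have "?M * (2*n choose n) \<le> D" using D(1) by (simp add: dvd_imp_le)
      also note D(3)
      finally have "real (?M * (2*n choose n)) \<le> real (?M ^ nat \<lfloor>sqrt ?M\<rfloor> * 4 ^ y)"
        by (rule of_nat_mono)
      then have le: "real ?M * real (2*n choose n) \<le> real ?M ^ nat \<lfloor>sqrt ?M\<rfloor> * 4 ^ y"
        by (simp only: of_nat_mult of_nat_power of_nat_numeral)
      have "4 powr n / (2 * real n) * ?M \<le> real (2*n choose n) * ?M"
        using central_binomial_lower_bound[of n] elim
        by (intro mult_right_mono) (auto simp: powr_realpow)
      also have "\<dots> \<le> real ?M ^ nat \<lfloor>sqrt ?M\<rfloor> * 4 ^ y" using le by (simp add: mult.commute)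
      also have "\<dots> = real ?M powr (nat \<lfloor>sqrt ?M\<rfloor>) * 4 powr y"
        by (subst (1 2) powr_realpow) auto
      also have "\<dots> \<le> real ?M powr sqrt ?M * 4 powr (5 * n / 6)"
        unfolding y_def by (intro mult_mono powr_mono) (use of_nat_div_le_of_nat[of "5 * n" 6] in simp_all)
      finally show False using elim by (simp add: add.commute)
    qed
  qed
qed

section \<open>Sidon sets\<close>

text \<open>Modulus 0 gives Sidon sets of integers.\<close>

definition sidon_mod :: "int \<Rightarrow> int set \<Rightarrow> bool" where
  "sidon_mod m A \<longleftrightarrow> (\<forall>a\<in>A. \<forall>b\<in>A. \<forall>c\<in>A. \<forall>d\<in>A. [a - b = c - d] (mod m) \<longrightarrow> a = b \<or> a = c)"

lemma sidon_modD:
  "sidon_mod m A \<Longrightarrow> [a - b = c - d] (mod m) \<Longrightarrow> a \<in> A \<Longrightarrow> b \<in> A \<Longrightarrow> c \<in> A \<Longrightarrow> d \<in> A \<Longrightarrow>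
    a = b \<or> a = c"
  unfolding sidon_mod_def by blast

text \<open>
  The elements are the residues congruent to \<open>i\<close> modulo \<open>p - 1\<close> and to \<open>g ^ i\<close> modulo \<open>p\<close>. Equal
  differences give two pairs of powers of \<open>g\<close> with the same sum and the same product.
\<close>

lemma ruzsa_sidon_set:
  fixes p :: nat
  assumes p: "prime p"
  obtains A where "A \<subseteq> {0..<int (p * (p - 1))}" "card A = p - 1" "sidon_mod (int (p * (p - 1))) A"
proof -
  have p2: "p \<ge> 2" using p by (rule prime_ge_2_nat)
  obtain g where g: "residue_primroot p g"
    using prime_primitive_root_exists[OF prime_gt_1_nat[OF p] p] by blast
  have cop: "coprime p g" and ord: "ord p g = p - 1"
    using g p by (auto simp: residue_primroot_def totient_prime)
  have pow_eq_iff: "[int (g ^ i) = int (g ^ j)] (mod int p) \<longleftrightarrow> [i = j] (mod (p - 1))" for i j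
    unfolding cong_int_iff using order_divides_expdiff[OF cop, of i j] unfolding ord .
  have cong_small: "i = j" if "[i = j] (mod (p - 1))" "i < p - 1" "j < p - 1" for i j
    using that by (simp add: cong_def)
  define m where "m = int (p * (p - 1))"
  define q where "q = int p - 1"
  have mq: "m = int p * q" using p2 by (simp add: m_def q_def of_nat_diff)
  have qn: "q = int (p - 1)" using p2 by (simp add: q_def of_nat_diff)
  have m0: "m > 0" using p2 by (simp add: m_def)
  \<comment> \<open>Explicit Chinese remaindering: \<open>p\<close> is 1 and \<open>q\<close> is 0
    modulo \<open>q\<close>, while \<open>p\<close> is 0 and \<open>- q\<close> is 1 modulo
    \<open>p\<close>.\<close>
  define a where "a i = (int p * int i - q * int (g ^ i)) mod m" for i
  have am: "[a i = int p * int i - q * int (g ^ i)] (mod m)" for i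
    by (simp add: a_def cong_def)
  have qm: "q dvd m" and pm: "int p dvd m" by (simp_all add: mq)
  have a1: "[a i = int i] (mod q)" for i
  proof -
    have "[a i = int p * int i - q * int (g ^ i)] (mod q)"
      using am qm by (rule cong_dvd_modulus)
    also have "[int p * int i - q * int (g ^ i) = int i] (mod q)"
      unfolding cong_iff_dvd_diff
      by (rule dvdI[of _ _ "int i - int (g ^ i)"]) (simp add: q_def algebra_simps)
    finally show ?thesis .
  qed
  have a2: "[a i = int (g ^ i)] (mod int p)" for i
  proof -
    have "[a i = int p * int i - q * int (g ^ i)] (mod int p)"
      using am pm by (rule cong_dvd_modulus)
    also have "[int p * int i - q * int (g ^ i) = int (g ^ i)] (mod int p)"
      unfolding cong_iff_dvd_diff
      by (rule dvdI[of _ _ "int i - int (g ^ i)"]) (simp add: q_def algebra_simps)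
    finally show ?thesis .
  qed
  have eqI: "i = j" if "a i = a j" "i < p - 1" "j < p - 1" for i j
  proof -
    have "[int i = int j] (mod q)" using a1[of i] a1[of j] that(1) by (simp add: cong_def)
    then show ?thesis using cong_small that unfolding qn cong_int_iff by blast
  qed
  show ?thesis
  proof
    show "a ` {..<p - 1} \<subseteq> {0..<int (p * (p - 1))}"
      unfolding m_def[symmetric] using m0 by (auto simp: a_def)
    show "card (a ` {..<p - 1}) = p - 1"
      by (subst card_image) (auto simp: inj_on_def intro: eqI)
    show "sidon_mod (int (p * (p - 1))) (a ` {..<p - 1})"
      unfolding sidon_mod_def m_def[symmetric]
    proof (intro ballI impI, elim imageE, goal_cases)
      case (1 _ _ _ _ i j k l)
      note ijkl = 1
      then have *: "[a i - a j = a k - a l] (mod m)" by simp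
      then have "[a i - a j = a k - a l] (mod q)" "[a i - a j = a k - a l] (mod int p)"
        using qm pm by (auto intro: cong_dvd_modulus)
      moreover have "[a i - a j = int i - int j] (mod q)" "[a k - a l = int k - int l] (mod q)"
        by (intro cong_diff a1)+
      moreover have "[a i - a j = int (g^i) - int (g^j)] (mod int p)"
          "[a k - a l = int (g^k) - int (g^l)] (mod int p)"
        by (intro cong_diff a2)+
      ultimately have 1: "[int i - int j = int k - int l] (mod q)"
        and 2: "[int (g^i) - int (g^j) = int (g^k) - int (g^l)] (mod int p)"
        by (meson cong_sym cong_trans)+
      \<comment> \<open>Rearranged into sums, the congruence of exponents says that
        \<open>g^j * g^k\<close> and \<open>g^i * g^l\<close> agree modulo \<open>p\<close>.\<close>
      have "[int (j + k) = int (i + l)] (mod q)"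
        using 1 unfolding cong_iff_dvd_diff
        by (subst dvd_minus_iff[symmetric]) (simp add: algebra_simps)
      then have "[j + k = i + l] (mod (p - 1))"
        unfolding qn cong_int_iff .
      then have "[int (g ^ (j + k)) = int (g ^ (i + l))] (mod int p)"
        by (simp only: pow_eq_iff)
      then have "int p dvd int (g^j) * int (g^k) - int (g^i) * int (g^l)"
        by (simp add: cong_iff_dvd_diff power_add)
      \<comment> \<open>Multiplying the difference relation by \<open>g^i\<close> and adding the
        product relation eliminates \<open>g^l\<close>; the result factors, and primality of
        \<open>p\<close> applies.\<close>
      moreover have "int p dvd int (g^i) * ((int (g^i) - int (g^j)) - (int (g^k) - int (g^l)))"
        using 2 by (simp add: cong_iff_dvd_diff)
      ultimately have "int p dvd int (g^i) * ((int (g^i) - int (g^j)) - (int (g^k) - int (g^l)))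
          + (int (g^j) * int (g^k) - int (g^i) * int (g^l))"
        by (rule dvd_add[rotated])
      also have "\<dots> = (int (g^i) - int (g^j)) * (int (g^i) - int (g^k))"
        by (simp only: algebra_simps)
      finally have "int p dvd int (g^i) - int (g^j) \<or> int p dvd int (g^i) - int (g^k)"
        using p by (simp add: prime_dvd_mult_iff)
      then have "[i = j] (mod (p - 1)) \<or> [i = k] (mod (p - 1))"
        by (simp only: cong_iff_dvd_diff[symmetric] pow_eq_iff)
      then show ?case using ijkl cong_small[of i j] cong_small[of i k] by auto
    qed
  qed
qed

section \<open>Passing to integer intervals and to residues modulo \<open>n\<close>\<close>

text \<open>Averaging over the \<open>m\<close> cyclic windows of length \<open>N\<close>: every
  element of \<open>A\<close> lies in exactly \<open>N\<close> of them, so some window holds at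
  least the average share.\<close>

lemma sidon_mod_window:
  assumes A: "finite A" "sidon_mod (int m) A" "A \<subseteq> {0..<int m}" and N: "N \<le> m" "m > 0"
  obtains B where "B \<subseteq> {0..<int N}" "sidon_mod 0 B" "N * card A \<le> m * card B"
proof -
  \<comment> \<open>The position of \<open>a\<close> counted cyclically from \<open>c\<close>;
    \<open>W c\<close> is then the part of \<open>A\<close> in the window starting at
    \<open>c\<close>.\<close>
  define sh where "sh c a = (a - c) mod int m" for c a
  define W where "W c = {a\<in>A. sh c a < int N}" for c
  have cnt: "card {c\<in>{0..<int m}. sh c a < int N} = N" for a
  proof -
    have inv: "(a - (a - x) mod int m) mod int m = x" if "0 \<le> x" "x < int m" for x
      using that by (simp add: mod_diff_right_eq)
    have "bij_betw (\<lambda>x. (a - x) mod int m) {0..<int N} {c\<in>{0..<int m}. sh c a < int N}"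
      by (rule bij_betwI[where g = "\<lambda>c. sh c a"]) (use N inv in \<open>auto simp: sh_def\<close>)
    then show ?thesis using bij_betw_same_card by fastforce
  qed
  have "N * card A = (\<Sum>a\<in>A. card {c\<in>{0..<int m}. sh c a < int N})"
    by (simp only: cnt sum_constant of_nat_id mult.commute)
  also have "\<dots> = (\<Sum>a\<in>A. \<Sum>c\<in>{0..<int m}. if sh c a < int N then 1 else 0)"
    by (simp add: sum.If_cases Int_def)
  also have "\<dots> = (\<Sum>c\<in>{0..<int m}. \<Sum>a\<in>A. if sh c a < int N then 1 else 0)"
    by (rule sum.swap)
  also have "\<dots> = (\<Sum>c\<in>{0..<int m}. card (W c))"
    using A(1) by (simp add: sum.If_cases Int_def W_def)
  finally have sum: "N * card A = (\<Sum>c\<in>{0..<int m}. card (W c))" .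
  have "\<exists>c. N * card A \<le> m * card (W c)"
  proof (rule ccontr)
    assume "\<nexists>c. N * card A \<le> m * card (W c)"
    then have "m * card (W c) < N * card A" for c by (simp add: not_le)
    then have "(\<Sum>c\<in>{0..<int m}. m * card (W c)) < (\<Sum>c\<in>{0..<int m}. N * card A)"
      using N by (intro sum_strict_mono) auto
    then show False unfolding sum_distrib_left[symmetric] sum[symmetric] by simp
  qed
  then obtain c where c: "N * card A \<le> m * card (W c)" by blast
  \<comment> \<open>Shifting preserves differences modulo \<open>m\<close>, so equal integer
    differences after the shift come from congruent differences in \<open>A\<close>.\<close>
  have cong: "[sh c a - sh c b = a - b] (mod int m)" for a b
    by (simp add: sh_def cong_def mod_simps)
  have inj: "inj_on (sh c) A"
  proof (rule inj_onI)
    fix a b assume *: "a \<in> A" "b \<in> A" "sh c a = sh c b"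
    then have "[b = a] (mod int m)"
      using cong[of a b] by (simp add: cong_iff_dvd_diff)
    moreover have "a \<in> {0..<int m}" "b \<in> {0..<int m}" using * A(3) by blast+
    ultimately show "a = b" by (simp add: cong_def)
  qed
  show ?thesis
  proof
    show "sh c ` W c \<subseteq> {0..<int N}" using N by (auto simp: W_def sh_def)
    have "card (sh c ` W c) = card (W c)"
      by (rule card_image) (rule inj_on_subset[OF inj], auto simp: W_def)
    then show "N * card A \<le> m * card (sh c ` W c)" using c by simp
    show "sidon_mod 0 (sh c ` W c)"
      unfolding sidon_mod_def
    proof (intro ballI impI, elim imageE, goal_cases)
      case (1 _ _ _ _ i j k l)
      then have "[i - j = k - l] (mod int m)"
        using cong[of i j] cong[of k l] by (simp add: cong_def)
      then have "i = j \<or> i = k" using sidon_modD[OF A(2)] 1 by (simp add: W_def)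
      then show ?case using 1 by auto
    qed
  qed
qed

text \<open>If \<open>p * (p - 1)\<close> is at most \<open>N\<close>, the whole Ruzsa set fits and
  has \<open>p - 1\<close> elements; otherwise the best window keeps at least \<open>N / p\<close>
  of them.\<close>

lemma sidon_in_interval:
  fixes p N :: nat
  assumes "prime p"
  obtains B where "B \<subseteq> {0..<int N}" "sidon_mod 0 B" "real (card B) \<ge> min (real p - 1) (real N / real p)"
proof -
  obtain A where A: "A \<subseteq> {0..<int (p * (p - 1))}" "card A = p - 1" "sidon_mod (int (p * (p - 1))) A"
    using ruzsa_sidon_set[OF assms] by blast
  have p2: "p \<ge> 2" using assms by (rule prime_ge_2_nat)
  show ?thesis
  proof (cases "p * (p - 1) \<le> N")
    case True
    have "sidon_mod 0 A"
      unfolding sidon_mod_def using sidon_modD[OF A(3)] by (metis cong_def mod_by_0)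
    moreover have "A \<subseteq> {0..<int N}" using A(1) True by (force simp: of_nat_mult[symmetric] simp del: of_nat_mult)
    ultimately show ?thesis using that[of A] A(2) p2 by (simp add: of_nat_diff)
  next
    case False
    have "finite A" using A(1) finite_subset by blast
    then obtain B where B: "B \<subseteq> {0..<int N}" "sidon_mod 0 B" "N * card A \<le> p * (p - 1) * card B"
      using sidon_mod_window[OF _ A(3) A(1), of N] False p2 by auto
    then have "N * (p - 1) \<le> p * card B * (p - 1)" using A(2) by (simp add: ac_simps)
    then have "N \<le> p * card B" using p2 by simp
    then have "real N \<le> real p * real (card B)" by (metis of_nat_le_iff of_nat_mult)
    then have "real N / real p \<le> real (card B)" using p2 by (simp add: field_simps)
    then show ?thesis using that[of B] B by simp
  qed
qed

text \<open>A residue class modulo \<open>n\<close> has \<open>2 * g\<close> members in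
  \<open>[- g * n, g * n)\<close>, each nonzero one the difference of at most one pair from
  \<open>B\<close>. Applied to class 0, the same count bounds the collisions, so reduction loses at
  most \<open>2 * g\<close> elements.\<close>

lemma sidon_reduce_mod:
  fixes n g :: nat
  assumes n: "n > 0" and B: "B \<subseteq> {0..<int (g * n)}" "sidon_mod 0 B"
  obtains S where "S \<subseteq> {..<n}" "card B \<le> card S + 2 * g"
    "\<And>d. 0 < d \<Longrightarrow> d < n \<Longrightarrow> card {s\<in>S. (s + d) mod n \<in> S} \<le> 2 * g"
proof -
  define D where "D d = {(x, y). x \<in> B \<and> y \<in> B \<and> x \<noteq> y \<and> (x - y) mod int n = d}" for d
  have finB: "finite B" using B(1) finite_subset by blast
  have finD: "finite (D d)" for d
    by (rule finite_subset[of _ "B \<times> B"]) (auto simp: D_def finB)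
  have cardD: "card (D d) \<le> 2 * g" for d
  proof -
    \<comment> \<open>Within \<open>D d\<close> the quotient fixes the difference
      \<open>x - y\<close>, and the Sidon property then fixes the pair.\<close>
    let ?q = "\<lambda>(x, y). (x - y) div int n"
    have "inj_on ?q (D d)"
    proof (rule inj_onI, clarify)
      fix x y x' y' assume *: "(x, y) \<in> D d" "(x', y') \<in> D d" "(x - y) div int n = (x' - y') div int n"
      then have "(x - y) mod int n = (x' - y') mod int n" by (simp add: D_def)
      then have "x - y = x' - y'" using *(3) by (metis mult_div_mod_eq)
      then show "x = x' \<and> y = y'"
        using * sidon_modD[OF B(2), of x y x' y'] by (auto simp: D_def)
    qed
    moreover have "?q ` D d \<subseteq> {- int g..<int g}"
    proof clarify
      fix x y assume "(x, y) \<in> D d"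
      then have "x \<in> {0..<int g * int n}" "y \<in> {0..<int g * int n}"
        using B(1) by (auto simp: D_def)
      then have b: "x - y < int n * int g" "- (int n * int g) \<le> x - y"
        by (simp_all add: mult.commute)
      define q r where "q = (x - y) div int n" and "r = (x - y) mod int n"
      have "int n * q + r = x - y" "0 \<le> r" "r < int n" using n by (simp_all add: q_def r_def)
      then have "int n * q < int n * int g" "int n * (- int g) < int n * (q + 1)"
        using b unfolding distrib_left mult_minus_right mult_1_right by linarith+
      then have "q < int g" "- int g < q + 1"
        using n by (simp_all only: mult_less_cancel_left_pos of_nat_0_less_iff)
      then show "(x - y) div int n \<in> {- int g..<int g}" by (simp add: q_def)
    qed
    ultimately have "card (D d) \<le> card {- int g..<int g}"
      using card_inj_on_le by blast
    then show ?thesis by simp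
  qed
  define r where "r b = nat (b mod int n)" for b
  define S where "S = r ` B"
  \<comment> \<open>Chooses one representative in \<open>B\<close> for each residue in
    \<open>S\<close>.\<close>
  define f where "f = inv_into B r"
  have f: "f s \<in> B" "r (f s) = s" if "s \<in> S" for s
    using that unfolding f_def S_def by (auto simp: inv_into_into f_inv_into_f)
  have rmod: "int (r b) = b mod int n" for b using n by (simp add: r_def)
  have fmod: "f s mod int n = int s" if "s \<in> S" for s
    using rmod[of "f s"] f(2)[OF that] by simp
  show ?thesis
  proof
    show "S \<subseteq> {..<n}" using n by (auto simp: S_def r_def nat_less_iff)
    \<comment> \<open>Elements that are not the representative of their residue: paired with it,
      they inject into \<open>D 0\<close>.\<close>
    define C where "C = {b\<in>B. f (r b) \<noteq> b}"
    have "(\<lambda>b. (b, f (r b))) ` C \<subseteq> D 0"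
    proof (clarify)
      fix b assume b: "b \<in> C"
      then have "r b \<in> S" by (auto simp: C_def S_def)
      then have "b mod int n = f (r b) mod int n" using fmod rmod by simp
      then have "(b - f (r b)) mod int n = 0" by (simp add: mod_eq_dvd_iff)
      then show "(b, f (r b)) \<in> D 0" using b f \<open>r b \<in> S\<close> by (auto simp: D_def C_def)
    qed
    then have "card C \<le> card (D 0)"
      using finD by (intro card_inj_on_le[of "\<lambda>b. (b, f (r b))"]) (auto simp: inj_on_def)
    moreover have "B \<subseteq> f ` S \<union> C" by (force simp: C_def S_def)
    then have "card B \<le> card (f ` S \<union> C)"
      using finB by (intro card_mono) (auto simp: S_def C_def)
    ultimately show "card B \<le> card S + 2 * g"
      using cardD[of 0] card_Un_le[of "f ` S" C] card_image_le[of S f] finB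
      by (force simp: S_def)
    fix d :: nat assume d: "0 < d" "d < n"
    let ?X = "{s\<in>S. (s + d) mod n \<in> S}"
    let ?h = "\<lambda>s. (f ((s + d) mod n), f s)"
    have "inj_on ?h ?X" by (rule inj_onI) (metis (no_types, lifting) f(2) mem_Collect_eq prod.inject)
    moreover have "?h ` ?X \<subseteq> D (int d)"
    proof clarify
      fix s assume s: "s \<in> S" "(s + d) mod n \<in> S"
      have "(f ((s + d) mod n) - f s) mod int n = (f ((s + d) mod n) mod int n - f s mod int n) mod int n"
        by (simp add: mod_diff_eq)
      also have "\<dots> = (int ((s + d) mod n) - int s) mod int n"
        using fmod s by simp
      also have "\<dots> = int d mod int n" by (simp add: zmod_int mod_diff_left_eq)
      also have "\<dots> = int d" using d by simp
      finally have e: "(f ((s + d) mod n) - f s) mod int n = int d" .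
      then have "f ((s + d) mod n) \<noteq> f s" using d by auto
      then show "?h s \<in> D (int d)" using e f s by (simp add: D_def)
    qed
    ultimately have "card ?X \<le> card (D (int d))" using finD card_inj_on_le by blast
    then show "card ?X \<le> 2 * g" using cardD le_trans by blast
  qed
qed

section \<open>Sum graphs with matched loops\<close>

text \<open>\<open>R\<close> stands for adjacency, which the matching must avoid; the involution
  \<open>M\<close> on \<open>T\<close> encodes the matching. Two distinct unrelated elements are
  matched and removed until only a clique remains.\<close>

lemma maximal_pairing:
  assumes "finite L" and sym: "\<And>x y. R x y \<Longrightarrow> R y x"
  shows "\<exists>T M. T \<subseteq> L \<and> (\<forall>x\<in>T. M x \<in> T \<and> M x \<noteq> x \<and> M (M x) = x \<and> \<not> R x (M x)) \<and>
    (\<forall>x\<in>L - T. \<forall>y\<in>L - T. x \<noteq> y \<longrightarrow> R x y)"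
  using \<open>finite L\<close>
proof (induction L rule: finite_psubset_induct)
  case (psubset L)
  show ?case
  proof (cases "\<forall>x\<in>L. \<forall>y\<in>L. x \<noteq> y \<longrightarrow> R x y")
    case True
    then show ?thesis
      by - (rule exI[where x = "{}"], rule exI[where x = id], simp)
  next
    case False
    then obtain x y where xy: "x \<in> L" "y \<in> L" "x \<noteq> y" "\<not> R x y" by blast
    have "L - {x, y} \<subset> L" using xy by blast
    then obtain T M where TM: "T \<subseteq> L - {x, y} \<and>
        (\<forall>z\<in>T. M z \<in> T \<and> M z \<noteq> z \<and> M (M z) = z \<and> \<not> R z (M z)) \<and>
        (\<forall>u\<in>L - {x, y} - T. \<forall>v\<in>L - {x, y} - T. u \<noteq> v \<longrightarrow> R u v)"
      using psubset.IH[of "L - {x, y}"] by - (drule meta_mp, assumption, elim exE, rule that, assumption)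
    note T = TM[THEN conjunct1] and M = TM[THEN conjunct2, THEN conjunct1]
      and R = TM[THEN conjunct2, THEN conjunct2]
    let ?T = "insert x (insert y T)" and ?M = "M(x := y, y := x)"
    have 1: "?T \<subseteq> L" using T xy by blast
    have 2: "?M z \<in> ?T \<and> ?M z \<noteq> z \<and> ?M (?M z) = z \<and> \<not> R z (?M z)" if "z \<in> ?T" for z
    proof (cases "z \<in> T")
      case True
      then have "M z \<in> T" "z \<notin> {x, y}" "M z \<notin> {x, y}" using T M by blast+
      then show ?thesis using M True by simp
    next
      case False
      then show ?thesis using that xy sym by auto
    qed
    have "L - ?T = L - {x, y} - T" by blast
    then have 3: "\<forall>u\<in>L - ?T. \<forall>v\<in>L - ?T. u \<noteq> v \<longrightarrow> R u v" using R by (simp only:)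
    show ?thesis
      by (rule exI[where x = ?T], rule exI[where x = ?M], rule conjI[OF 1 conjI[OF ballI[OF 2] 3]])
  qed
qed

lemma bij_betw_add_mod: "bij_betw (\<lambda>w. (u + w) mod n) {..<n} {..<n::nat}"
proof -
  have "inj_on (\<lambda>w. (u + w) mod n) {..<n}"
  proof (rule inj_onI)
    fix w w' assume *: "w \<in> {..<n}" "w' \<in> {..<n}" "(u + w) mod n = (u + w') mod n"
    then have "[w = w'] (mod n)" using cong_add_lcancel_nat[of u w w' n] by (simp add: cong_def)
    then show "w = w'" using * by (simp add: cong_def)
  qed
  moreover have "(\<lambda>w. (u + w) mod n) ` {..<n} \<subseteq> {..<n}" by auto
  ultimately show ?thesis by (simp add: bij_betw_def endo_inj_surj)
qed

text \<open>2 is invertible modulo an odd \<open>n\<close>. Hence each element of \<open>S\<close>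
  produces exactly one loop.\<close>

lemma bij_betw_double_mod:
  assumes "odd n"
  shows "bij_betw (\<lambda>w. 2 * w mod n) {..<n} {..<n::nat}"
proof -
  have "inj_on (\<lambda>w. 2 * w mod n) {..<n}"
  proof (rule inj_onI)
    fix w w' assume *: "w \<in> {..<n}" "w' \<in> {..<n}" "2 * w mod n = 2 * w' mod n"
    then have "[w = w'] (mod n)"
      using cong_mult_lcancel_nat[of 2 n w w'] assms by (simp add: cong_def)
    then show "w = w'" using * by (simp add: cong_def)
  qed
  moreover have "(\<lambda>w. 2 * w mod n) ` {..<n} \<subseteq> {..<n}" using odd_pos[OF assms] by (simp add: image_subset_iff)
  ultimately show ?thesis by (simp add: bij_betw_def endo_inj_surj)
qed

text \<open>With \<open>d = v - u\<close> modulo \<open>n\<close>, sending \<open>w\<close> to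
  \<open>u + w\<close> injects the common neighbours into the \<open>s\<close> in \<open>S\<close>
  with \<open>s + d\<close> in \<open>S\<close>.\<close>

lemma card_common_sum_neighbours:
  fixes n :: nat
  assumes shift: "\<And>d. 0 < d \<Longrightarrow> d < n \<Longrightarrow> card {s\<in>S. (s + d) mod n \<in> S} \<le> c" and S: "S \<subseteq> {..<n}"
    and uv: "u < n" "v < n" "u \<noteq> v"
  shows "card {w\<in>{..<n}. (u + w) mod n \<in> S \<and> (v + w) mod n \<in> S} \<le> c"
proof -
  \<comment> \<open>Adding \<open>n\<close> first keeps the subtraction on naturals from
    truncating.\<close>
  define d where "d = (v + n - u) mod n"
  have "d = (if u \<le> v then v - u else v + n - u)"
  proof (cases "u \<le> v")
    case True
    then have "v + n - u = (v - u) + n" by simp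
    then have "d = (v - u) mod n" by (simp only: d_def mod_add_self2)
    then show ?thesis using True uv by simp
  qed (use uv in \<open>simp add: d_def\<close>)
  then have d: "0 < d" "d < n" using uv by (auto split: if_splits)
  have e: "((u + w) mod n + d) mod n = (v + w) mod n" for w
  proof -
    have "((u + w) mod n + d) mod n = (u + w + (v + n - u)) mod n" by (simp add: d_def mod_simps)
    also have "u + w + (v + n - u) = (v + w) + n" using uv by simp
    finally show ?thesis by simp
  qed
  have "card {w\<in>{..<n}. (u + w) mod n \<in> S \<and> (v + w) mod n \<in> S} \<le> card {s\<in>S. (s + d) mod n \<in> S}"
  proof (rule card_inj_on_le)
    show "inj_on (\<lambda>w. (u + w) mod n) {w\<in>{..<n}. (u + w) mod n \<in> S \<and> (v + w) mod n \<in> S}"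
      by (rule inj_on_subset[OF bij_betw_imp_inj_on[OF bij_betw_add_mod]]) auto
    show "finite {s\<in>S. (s + d) mod n \<in> S}" by (rule finite_subset[of _ "{..<n}"]) (use S in auto)
  qed (auto simp: e)
  also have "\<dots> \<le> c" using shift d by blast
  finally show ?thesis .
qed

text \<open>
  The matching must avoid existing edges, so take a maximal one in the complement, restricted to the
  loop vertices \<open>L\<close>. The unmatched loop vertices form a clique, which is small because any two of
  its members have few common neighbours; their elements are dropped from \<open>S\<close>.
\<close>

lemma regular_sum_graph:
  fixes n :: nat
  assumes n: "odd n" and S: "S \<subseteq> {..<n}"
    and shift: "\<And>d. 0 < d \<Longrightarrow> d < n \<Longrightarrow> card {s\<in>S. (s + d) mod n \<in> S} \<le> c"
  obtains E k where "\<And>u v. E u v \<Longrightarrow> E v u \<and> u \<noteq> v \<and> u < n"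
    "\<And>u. u < n \<Longrightarrow> card {w. E u w} = k" "card S \<le> k + c + 1"
    "\<And>u v. u \<noteq> v \<Longrightarrow> card {w. E u w \<and> E v w} \<le> c + 2"
proof -
  let ?dbl = "\<lambda>w. 2 * w mod n"
  have inj: "inj_on ?dbl {..<n}"
    by (rule bij_betw_imp_inj_on[OF bij_betw_double_mod[OF n]])
  have img: "?dbl ` {..<n} = {..<n}"
    by (rule bij_betw_imp_surj_on[OF bij_betw_double_mod[OF n]])
  define L where "L = {l\<in>{..<n}. ?dbl l \<in> S}"
  have "?dbl ` L = S"
  proof (intro equalityI subsetI)
    fix s assume s: "s \<in> S"
    then have "s \<in> ?dbl ` {..<n}" using S img by blast
    then show "s \<in> ?dbl ` L" using s unfolding L_def by blast
  qed (auto simp: L_def)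
  moreover have "inj_on ?dbl L" by (rule inj_on_subset[OF inj]) (auto simp: L_def)
  ultimately have cardL: "card L = card S" using card_image by metis
  have "\<exists>T M. T \<subseteq> L \<and> (\<forall>x\<in>T. M x \<in> T \<and> M x \<noteq> x \<and> M (M x) = x \<and> \<not> (x + M x) mod n \<in> S) \<and>
      (\<forall>x\<in>L - T. \<forall>y\<in>L - T. x \<noteq> y \<longrightarrow> (x + y) mod n \<in> S)"
    by (rule maximal_pairing) (simp_all add: L_def add.commute)
  then obtain T M where TM: "T \<subseteq> L \<and>
      (\<forall>x\<in>T. M x \<in> T \<and> M x \<noteq> x \<and> M (M x) = x \<and> \<not> (x + M x) mod n \<in> S) \<and>
      (\<forall>x\<in>L - T. \<forall>y\<in>L - T. x \<noteq> y \<longrightarrow> (x + y) mod n \<in> S)"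
    by (elim exE)
  note T = TM[THEN conjunct1]
  note M = TM[THEN conjunct2, THEN conjunct1, THEN bspec]
  have clique: "(x + y) mod n \<in> S" if "x \<in> L - T" "y \<in> L - T" "x \<noteq> y" for x y
    using TM[THEN conjunct2, THEN conjunct2] that by simp
  have finL: "finite L" by (simp add: L_def)
  have Tn: "T \<subseteq> {..<n}" using T by (auto simp: L_def)
  have rest: "card (L - T) \<le> c + 1"
  proof (cases "\<exists>x\<in>L - T. \<exists>y\<in>L - T. x \<noteq> y")
    case True
    then obtain x y where xy: "x \<in> L - T" "y \<in> L - T" "x \<noteq> y" by blast
    \<comment> \<open>Because of their loops, \<open>x\<close> and \<open>y\<close> are themselves
      common neighbours of the two, so the whole of \<open>L - T\<close> is counted.\<close>
    have self: "(x + x) mod n \<in> S" if "x \<in> L" for x using that by (simp add: L_def mult_2)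
    have "L - T \<subseteq> {w\<in>{..<n}. (x + w) mod n \<in> S \<and> (y + w) mod n \<in> S}"
      using clique self xy unfolding L_def by (auto simp: add.commute)
    then have "card (L - T) \<le> card {w\<in>{..<n}. (x + w) mod n \<in> S \<and> (y + w) mod n \<in> S}"
      by (intro card_mono) auto
    also have "\<dots> \<le> c"
      by (rule card_common_sum_neighbours[OF shift S]) (use xy in \<open>auto simp: L_def\<close>)
    finally show ?thesis by simp
  next
    case False
    then have "card (L - T) \<le> Suc 0" by (subst card_le_Suc0_iff_eq) (auto simp: L_def)
    then show ?thesis by simp
  qed
  \<comment> \<open>Only sums whose loop vertex is matched are kept, so the loops of
    \<open>S'\<close> sit exactly on \<open>T\<close>.\<close>
  define S' where "S' = ?dbl ` T"
  have S': "S' \<subseteq> S" using T by (auto simp: S'_def L_def)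
  have cardS': "card S' = card T"
    unfolding S'_def by (rule card_image, rule inj_on_subset[OF inj Tn])
  define E where "E u v \<longleftrightarrow> u < n \<and> v < n \<and> u \<noteq> v \<and> ((u + v) mod n \<in> S' \<or> u \<in> T \<and> v = M u)" for u v
  show ?thesis
  proof
    show "E v u \<and> u \<noteq> v \<and> u < n" if "E u v" for u v
      using that M[of u] unfolding E_def by (auto simp: add.commute)
    show "card S \<le> card T + c + 1"
    proof -
      have "card L = card T + card (L - T)"
        using T by (subst card_Diff_subset) (use finL in \<open>auto simp: card_mono intro: finite_subset\<close>)
      then show ?thesis using rest cardL by simp
    qed
    show "card {w. E u w} = card T" if u: "u < n" for u
    proof -
      define W where "W = {w\<in>{..<n}. (u + w) mod n \<in> S'}"
      have "bij_betw (\<lambda>w. (u + w) mod n) W S'"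
      proof (rule bij_betw_subset[OF bij_betw_add_mod])
        have "S' \<subseteq> (\<lambda>w. (u + w) mod n) ` {..<n}"
          using S S' bij_betw_imp_surj_on[OF bij_betw_add_mod[of u n]] by simp
        then show "(\<lambda>w. (u + w) mod n) ` W = S'" by (auto simp: W_def)
      qed (auto simp: W_def)
      then have cardW: "card W = card T" using cardS' bij_betw_same_card by metis
      have fin: "finite W" by (simp add: W_def)
      have uW: "u \<in> W \<longleftrightarrow> u \<in> T"
        unfolding W_def S'_def using u inj_on_image_mem_iff[OF inj _ Tn, of u] by (simp add: mult_2)
      show ?thesis
      proof (cases "u \<in> T")
        case True
        \<comment> \<open>A loop vertex loses itself as a neighbour and gains its partner, which is
          new because the matching avoids sums in \<open>S\<close>.\<close>
        then have Mu: "M u \<notin> W" "M u < n" "M u \<noteq> u" using M[OF True] S' Tn by (auto simp: W_def)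
        have "{w. E u w} = insert (M u) (W - {u})"
          using u True Mu by (auto simp: E_def W_def)
        then have "card {w. E u w} = Suc (card (W - {u}))" using Mu fin by simp
        then show ?thesis using card_Suc_Diff1[OF fin] True uW cardW by simp
      next
        case False
        then have "{w. E u w} = W" using u uW by (auto simp: E_def W_def)
        then show ?thesis using cardW by simp
      qed
    qed
    show "card {w. E u w \<and> E v w} \<le> c + 2" if uv: "u \<noteq> v" for u v
    proof (cases "u < n \<and> v < n")
      case True
      let ?C = "{w\<in>{..<n}. (u + w) mod n \<in> S \<and> (v + w) mod n \<in> S}"
      \<comment> \<open>Edges not coming from sums are matching edges, at most one at each of
        \<open>u\<close> and \<open>v\<close>.\<close>
      have "{w. E u w \<and> E v w} \<subseteq> ?C \<union> {M u, M v}"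
        using S' by (auto simp: E_def)
      then have "card {w. E u w \<and> E v w} \<le> card (?C \<union> {M u, M v})"
        by (intro card_mono) auto
      also have "\<dots> \<le> card ?C + card {M u, M v}" by (rule card_Un_le)
      also have "card ?C \<le> c"
        using True by (intro card_common_sum_neighbours[OF shift S] uv) auto
      also have "card {M u, M v} \<le> 2" by (simp add: card_insert_if)
      finally show ?thesis by simp
    next
      case False
      then have "{w. E u w \<and> E v w} = {}" by (auto simp: E_def)
      then show ?thesis by (metis card.empty zero_le)
    qed
  qed
qed

section \<open>From symmetric relations to graphs in the library\<close>

definition digraph_of :: "nat \<Rightarrow> (nat \<Rightarrow> nat \<Rightarrow> bool) \<Rightarrow> (nat, nat \<times> nat) pre_digraph" where
  "digraph_of n E = \<lparr>verts = {..<n}, arcs = {(u, v). E u v}, tail = fst, head = snd\<rparr>"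

lemma regular_digraph_of:
  assumes E: "\<And>u v. E u v \<Longrightarrow> E v u \<and> u \<noteq> v \<and> u < n"
    and deg: "\<And>u. u < n \<Longrightarrow> card {w. E u w} = k"
  shows "regular_graph k (digraph_of n E)"
  unfolding regular_graph_def
proof
  have irr: "u \<noteq> v" and lt: "u < n" "v < n" and symE: "E v u" if "E u v" for u v
    using E that by blast+
  have "finite {(u, v). E u v}"
    by (rule finite_subset[of _ "{..<n} \<times> {..<n}"]) (use E in blast)+
  then show "graph (digraph_of n E)"
    by unfold_locales (auto simp: digraph_of_def arc_to_ends_def symmetric_conv dest: irr lt intro: symE)
  show "\<forall>v\<in>verts (digraph_of n E). out_degree (digraph_of n E) v = k"
  proof
    fix u assume "u \<in> verts (digraph_of n E)"
    then have u: "u < n" by (simp add: digraph_of_def)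
    have "out_arcs (digraph_of n E) u = Pair u ` {w. E u w}"
      by (auto simp: out_arcs_def digraph_of_def)
    then show "out_degree (digraph_of n E) u = k"
      using deg[OF u] by (simp add: out_degree_def card_image inj_on_def)
  qed
qed

text \<open>In a forbidden subgraph, the two vertices of one part would have all \<open>b\<close>
  vertices of the other as common neighbours.\<close>

lemma complete_bipartite_free_digraph_of:
  assumes E: "\<And>u v. E u v \<Longrightarrow> E v u \<and> u < n"
    and codeg: "\<And>u v. u \<noteq> v \<Longrightarrow> card {w. E u w \<and> E v w} < b"
  shows "complete_bipartite_free 2 b (digraph_of n E)"
  unfolding complete_bipartite_free_def
proof (clarify)
  fix H assume sub: "subgraph H (digraph_of n E)" and K: "K\<^bsub>2,b\<^esub> H"
  obtain U V where UV: "card U = 2" "card V = b" "arcs_ends H = U \<times> V \<union> V \<times> U"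
    using K unfolding complete_bipartite_digraph_def by blast
  obtain u v where uv: "U = {u, v}" "u \<noteq> v" using UV(1) by (auto simp: card_2_iff)
  have "arcs_ends H \<subseteq> {(x, y). E x y}"
    using sub by (auto simp: subgraph_def compatible_def digraph_of_def arcs_ends_conv)
  then have "V \<subseteq> {w. E u w \<and> E v w}" using UV(3) uv by auto
  moreover have "finite {w. E u w \<and> E v w}"
    by (rule finite_subset[of _ "{..<n}"]) (use E in blast)+
  ultimately have "b \<le> card {w. E u w \<and> E v w}" using UV(2) card_mono by blast
  then show False using codeg[OF uv(2)] by simp
qed

section \<open>Choice of constants and the degree bound\<close>

lemma eventually_dense_sidon:
  "\<forall>\<^sub>F N in at_top. \<exists>B. B \<subseteq> {0..<int N} \<and> sidon_mod 0 B \<and> 16 / 25 * sqrt (real N) \<le> real (card B)"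
proof -
  obtain n\<^sub>0 where n\<^sub>0: "\<exists>p. prime p \<and> 5 * n < 6 * p \<and> p \<le> 2 * n + 1" if "n \<ge> n\<^sub>0" for n :: nat
    using eventually_prime_between unfolding eventually_sequentially by blast
  have "\<forall>\<^sub>F N :: nat in at_top. 39 / 50 * sqrt (real N) \<ge> real n\<^sub>0"
    by real_asymp
  \<comment> \<open>Absorbs the rounding in \<open>n\<close> and the additive constants in the
    bounds on \<open>p\<close>.\<close>
  moreover have "\<forall>\<^sub>F N :: nat in at_top. sqrt (real N) \<ge> 1000"
    by real_asymp
  ultimately show ?thesis
  proof eventually_elim
    case (elim N)
    define s where "s = sqrt (real N)"
    have s: "s \<ge> 1000" "s * s = real N" using elim by (simp_all add: s_def)
    \<comment> \<open>The factor \<open>39 / 50\<close> puts \<open>p\<close> between about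
      \<open>0.65 * s\<close> and \<open>1.56 * s\<close>. Both \<open>p - 1\<close> and
      \<open>N / p\<close> are then at least \<open>0.64 * s\<close>, since
      \<open>1.56 < 25 / 16 = 1 / 0.64\<close>.\<close>
    define n where "n = nat \<lfloor>39 / 50 * s\<rfloor>"
    have "n \<ge> n\<^sub>0" using elim unfolding n_def s_def by (intro le_nat_floor) simp
    from n\<^sub>0[OF this] obtain p where p: "prime p" "5 * n < 6 * p" "p \<le> 2 * n + 1" by blast
    have "real n = of_int \<lfloor>39 / 50 * s\<rfloor>" using s(1) by (simp add: n_def)
    then have n: "real n \<le> 39 / 50 * s" "39 / 50 * s - 1 \<le> real n" by linarith+
    have "5 * real n < 6 * real p" "real p \<le> 2 * real n + 1" using p by linarith+
    then have p_lower: "real p - 1 \<ge> 16 / 25 * s" and p_upper: "real p \<le> 25 / 16 * s"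
      using n s by linarith+
    have "16 / 25 * s * real p \<le> 16 / 25 * s * (25 / 16 * s)"
      using p_upper s by (intro mult_left_mono) auto
    also have "\<dots> = real N" using s by simp
    finally have "16 / 25 * s \<le> real N / real p"
      using prime_gt_0_nat[OF p(1)] by (simp add: field_simps)
    then have min: "16 / 25 * s \<le> min (real p - 1) (real N / real p)" using p_lower by simp
    obtain B where B: "B \<subseteq> {0..<int N}" "sidon_mod 0 B"
      "min (real p - 1) (real N / real p) \<le> real (card B)"
      using sidon_in_interval[OF p(1)] by blast
    then show ?case using min unfolding s_def by (intro exI[of _ B]) linarith
  qed
qed

theorem theorem4p8:
  fixes t :: nat and \<epsilon> :: real
  assumes "t \<ge> 1" and "even t" and "0 < \<epsilon>" and "\<epsilon> < 1 / 2"
  shows "\<exists>n\<^sub>0 :: nat. \<forall>n \<ge> n\<^sub>0. odd n \<longrightarrow>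
    (\<exists>(G :: (nat, nat \<times> nat) pre_digraph) (k :: nat).
       regular_graph k G \<and> card (verts G) = n \<and>
       complete_bipartite_free 2 (2 * t + 1) G \<and>
       real k \<ge> (1 - 2 * \<epsilon>) powr (1 / 2) * sqrt (real t * real n / 5))"
proof -
  define g where "g = t - 1"
  \<comment> \<open>An even \<open>t >= 1\<close> is at least 2, so \<open>g >= 1\<close> and hence
    \<open>t <= 2 * g\<close>.\<close>
  have t: "t = g + 1" "g \<ge> 1" using assms(1,2) unfolding g_def by (cases "t = 1", auto)
  obtain N\<^sub>0 where N\<^sub>0: "\<exists>B. B \<subseteq> {0..<int N} \<and> sidon_mod 0 B \<and> 16 / 25 * sqrt (real N) \<le> real (card B)"
    if "N \<ge> N\<^sub>0" for N :: nat
    using eventually_dense_sidon unfolding eventually_sequentially by blast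
  show ?thesis
  \<comment> \<open>The square makes \<open>sqrt (g * n)\<close> at least 200 times the total loss
    \<open>4 * g + 1\<close>; \<open>N\<^sub>0\<close> provides the dense Sidon set below
    \<open>g * n\<close>.\<close>
  proof (intro exI[of _ "N\<^sub>0 + (200 * (4 * g + 1))\<^sup>2"] allI impI)
    fix n assume n: "N\<^sub>0 + (200 * (4 * g + 1))\<^sup>2 \<le> n" "odd n"
    have gn: "n \<le> g * n" using t by simp
    define s where "s = sqrt (real (g * n))"
    have "real ((200 * (4 * g + 1))\<^sup>2) \<le> real (g * n)"
      using n(1) gn by (intro of_nat_mono) linarith
    then have "(200 * (4 * real g + 1))\<^sup>2 \<le> real (g * n)"
      by (simp only: of_nat_power of_nat_mult of_nat_add of_nat_numeral of_nat_1)
    then have s: "200 * (4 * real g + 1) \<le> s" unfolding s_def by (rule real_le_rsqrt)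
    obtain B where B: "B \<subseteq> {0..<int (g * n)}" "sidon_mod 0 B" "16 / 25 * s \<le> real (card B)"
      using N\<^sub>0[of "g * n"] n(1) gn unfolding s_def by auto
    obtain S where S: "S \<subseteq> {..<n}" "card B \<le> card S + 2 * g"
      "\<And>d. 0 < d \<Longrightarrow> d < n \<Longrightarrow> card {s\<in>S. (s + d) mod n \<in> S} \<le> 2 * g"
      using sidon_reduce_mod[OF odd_pos[OF n(2)] B(1,2)] by blast
    show "\<exists>(G :: (nat, nat \<times> nat) pre_digraph) (k :: nat).
       regular_graph k G \<and> card (verts G) = n \<and>
       complete_bipartite_free 2 (2 * t + 1) G \<and>
       real k \<ge> (1 - 2 * \<epsilon>) powr (1 / 2) * sqrt (real t * real n / 5)"
    proof (rule regular_sum_graph[OF n(2) S(1,3)])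
      fix E k
      assume E: "\<And>u v. E u v \<Longrightarrow> E v u \<and> u \<noteq> v \<and> u < n"
        and deg: "\<And>u. u < n \<Longrightarrow> card {w. E u w} = k" and k: "card S \<le> k + 2 * g + 1"
        and codeg: "\<And>u v. u \<noteq> v \<Longrightarrow> card {w. E u w \<and> E v w} \<le> 2 * g + 2"
      \<comment> \<open>The loss is \<open>2 * g\<close> from reduction modulo \<open>n\<close> plus
        \<open>2 * g + 1\<close> from unmatched loop vertices.\<close>
      have "real (card B) \<le> real k + (4 * real g + 1)" using S(2) k by linarith
      moreover have "4 * real g + 1 \<le> s / 200" using s by simp
      moreover have "127 / 200 * s = 16 / 25 * s - s / 200" by simp
      ultimately have "127 / 200 * s \<le> real k" using B(3) by linarith
      have "real t * real n / 5 \<le> 2 / 5 * real (g * n)"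
      proof -
        have "real t * real n \<le> (2 * real g) * real n" using t by (intro mult_right_mono) auto
        then show ?thesis by simp
      qed
      \<comment> \<open>The square of \<open>127 / 200 = 16 / 25 - 1 / 200\<close> is
        \<open>0.403225\<close>, just above \<open>2 / 5\<close>.\<close>
      also have "\<dots> \<le> (127 / 200)\<^sup>2 * s\<^sup>2" by (simp add: s_def power2_eq_square)
      also have "\<dots> = (127 / 200 * s)\<^sup>2" by (simp only: power_mult_distrib)
      finally have "sqrt (real t * real n / 5) \<le> 127 / 200 * s"
        using s by (intro real_le_lsqrt) auto
      with \<open>127 / 200 * s \<le> real k\<close> have "sqrt (real t * real n / 5) \<le> real k" by linarith
      moreover have "(1 - 2 * \<epsilon>) powr (1 / 2) \<le> 1"
        using assms(3,4) by (intro powr_le1) auto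
      then have "(1 - 2 * \<epsilon>) powr (1 / 2) * sqrt (real t * real n / 5) \<le> 1 * sqrt (real t * real n / 5)"
        by (intro mult_right_mono) auto
      ultimately have kbound: "real k \<ge> (1 - 2 * \<epsilon>) powr (1 / 2) * sqrt (real t * real n / 5)"
        by linarith
      \<comment> \<open>\<open>2 * g + 2 = 2 * t\<close>, one below the forbidden number of common
        neighbours.\<close>
      have codeg': "card {w. E u w \<and> E v w} < 2 * t + 1" if "u \<noteq> v" for u v
        using codeg[OF that] t by linarith
      have "regular_graph k (digraph_of n E)"
        using E deg by (rule regular_digraph_of)
      moreover have "card (verts (digraph_of n E)) = n" by (simp add: digraph_of_def)
      moreover have "complete_bipartite_free 2 (2 * t + 1) (digraph_of n E)"
        by (rule complete_bipartite_free_digraph_of[OF _ codeg']) (use E in blast)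
      ultimately show ?thesis
        using kbound by (intro exI[of _ "digraph_of n E"] exI[of _ k] conjI)
    qed
  qed
qed

end
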